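(* Let $V$ be a nondoubled word on any alphabet. Fix an integer $q>0$, and let $W_n\in[q]^n$ be chosen uniformly at random. Then $$\lim_{n\rightarrow\infty}\mathbb{E}(\delta(V,W_n))=\mathbb{I}(V,q).$$
   Context: A word is nondoubled if some letter occurs in it exactly once. $[q]=\{1,\dots,q\}$ and $[q]^n$ is the set of words of length $n$ over $[q]$. A word $U$ is an instance of $V$ (a $V$-instance) if $U=\phi(V)$ for some homomorphism $\phi$ of free monoids that is nonerasing (no letter is mapped to the empty word). For a word $W$ and $0\le i<j\le|W|$, $W[i,j]$ is the factor consisting of the $j-i$ consecutive letters of $W$ beginning with the $(i+1)$-th. The density of $V$ in $W$ is $$\delta(V,W)=\frac{|\{(i,j):0\le i<j\le|W|,\ W[i,j]\text{ is a }V\text{-instance}\}|}{\binom{|W|+1}{2}}.$$ $\mathbb{I}_n(V,q)$ is the probability that a uniformly random word in $[q]^n$ is a $V$-instance, and $\mathbb{I}(V,q)=\lim_{n\to\infty}\mathbb{I}_n(V,q)$ (this limit exists for nondoubled $V$). *)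

theory Defs
  imports "HOL-Probability.Probability"
begin

definition nondoubled :: "'a list \<Rightarrow> bool" where
  "nondoubled V \<longleftrightarrow> (\<exists>x\<in>set V. count_list V x = 1)"

definition nonerasing_hom :: "('a list \<Rightarrow> 'b list) \<Rightarrow> bool" where
  "nonerasing_hom \<phi> \<longleftrightarrow>
     \<phi> [] = [] \<and> (\<forall>u v. \<phi> (u @ v) = \<phi> u @ \<phi> v) \<and> (\<forall>x. \<phi> [x] \<noteq> [])"

definition is_instance :: "'a list \<Rightarrow> 'b list \<Rightarrow> bool" where
  "is_instance V U \<longleftrightarrow> (\<exists>\<phi>. nonerasing_hom \<phi> \<and> U = \<phi> V)"

definition factor :: "'b list \<Rightarrow> nat \<Rightarrow> nat \<Rightarrow> 'b list" where
  "factor W i j = take (j - i) (drop i W)"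

text \<open>For the empty word the denominator is \<open>0\<close>, so its density is \<open>0\<close> by convention.\<close>

definition density_in :: "'a list \<Rightarrow> 'b list \<Rightarrow> real" where
  "density_in V W =
     real (card {(i, j). i < j \<and> j \<le> length W \<and> is_instance V (factor W i j)})
       / real ((length W + 1) choose 2)"

definition words :: "nat \<Rightarrow> nat \<Rightarrow> nat list set" where
  "words q n = {w. set w \<subseteq> {1..q} \<and> length w = n}"

definition random_word :: "nat \<Rightarrow> nat \<Rightarrow> nat list pmf" where
  "random_word q n = pmf_of_set (words q n)"

definition instance_prob :: "nat \<Rightarrow> 'a list \<Rightarrow> nat \<Rightarrow> real" where
  "instance_prob n V q = measure_pmf.prob (random_word q n) {W. is_instance V W}"

text \<open>\<^const>\<open>lim\<close> is unspecified for divergent sequences, but for nondoubled \<open>V\<close> and \<open>q > 0\<close>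
  the sequence of instance probabilities converges.\<close>

definition limit_instance_prob :: "'a list \<Rightarrow> nat \<Rightarrow> real" where
  "limit_instance_prob V q = lim (\<lambda>n. instance_prob n V q)"

end

theory Submission
  imports Defs "HOL-Real_Asymp.Real_Asymp"
begin

text \<open>
  By linearity of expectation the expected density is an average of the probabilities
  \<open>instance_prob m V q\<close> over the \<open>n (n + 1) / 2\<close> factors of a word of length \<open>n\<close>, and most of
  these factors are long. Hence it has the same limit as the sequence of instance probabilities,
  as soon as that sequence converges. The convergence is the substance of the proof.

  Let \<open>x\<close> be a letter that occurs once in \<open>V\<close>, say \<open>V = A x B\<close>. Consider instances in which every
  letter but \<open>x\<close> has an image of length at most \<open>k\<close>. Whether a long word is such an instance depends
  only on a bounded prefix and a bounded suffix of it, since the image of \<open>x\<close> takes up whatever lies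
  between. The probability of being such an instance is therefore constant for large \<open>n\<close>
  (\<open>prob_bounded_instance_Suc\<close>). It remains to see that, for large \<open>k\<close>, all but a small proportion
  \<open>\<epsilon>\<close> of the words that are instances at all are instances in this bounded sense
  (\<open>bounded_suffices_nonrecurring\<close>). The instance probabilities then stay within \<open>\<epsilon>\<close> of a constant
  and form a Cauchy sequence. The proof of this is by induction on the length of \<open>V\<close>.

  If every letter other than \<open>x\<close> recurs, consider one with the longest image, of length \<open>m > k\<close>. Two
  copies of this image occur in the word, both starting within distance \<open>|V| m\<close> of one of its two
  ends, so that there are only polynomially many choices (in \<open>m\<close>) for their positions. Two given
  disjoint factors of length \<open>m\<close> agree with probability \<open>q\<^sup>-\<^sup>m\<close>, so the union bound gives the
  tail of a convergent series when \<open>q \<ge> 2\<close>. For \<open>q = 1\<close> there is only one word of each length.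

  If another letter \<open>y\<close> also occurs once, say \<open>V = P x Q y R\<close>, then a \<open>V\<close>-instance is in particular
  a \<open>P x R\<close>-instance: the image of \<open>x\<close> absorbs everything from \<open>x\<close> to \<open>y\<close>. By induction it is,
  almost always, a \<open>P x R\<close>-instance with bounded images for \<open>P\<close> and \<open>R\<close>. Conversely, the middle part
  of such a word is long and random, so with high probability some image of \<open>Q\<close> of the right kind
  appears in a bounded window close to its right end. Cutting there yields a bounded image of \<open>y\<close>. The
  case in which \<open>y\<close> precedes \<open>x\<close> follows by reversing all words.
\<close>

section \<open>Instances with bounded images\<close>

text \<open>A homomorphism of free monoids is given by the images of the letters.\<close>
lemma is_instance_iff_subst:
  "is_instance V U \<longleftrightarrow> (\<exists>f. (\<forall>y. f y \<noteq> []) \<and> U = concat (map f V))"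
proof
  assume "is_instance V U"
  then obtain \<phi> where \<phi>: "nonerasing_hom \<phi>" "U = \<phi> V"
    by (auto simp: is_instance_def)
  have "\<phi> V = concat (map (\<lambda>y. \<phi> [y]) V)" for V
  proof (induction V)
    case Nil
    then show ?case using \<phi> by (simp add: nonerasing_hom_def)
  next
    case (Cons a V)
    have "\<phi> ([a] @ V) = \<phi> [a] @ \<phi> V"
      using \<phi>(1) unfolding nonerasing_hom_def by blast
    then show ?case using Cons by simp
  qed
  then show "\<exists>f. (\<forall>y. f y \<noteq> []) \<and> U = concat (map f V)"
    using \<phi> unfolding nonerasing_hom_def by (intro exI[of _ "\<lambda>y. \<phi> [y]"]) blast
next
  assume "\<exists>f. (\<forall>y. f y \<noteq> []) \<and> U = concat (map f V)"
  then obtain f where "\<forall>y. f y \<noteq> []" "U = concat (map f V)" by blast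
  then show "is_instance V U"
    unfolding is_instance_def nonerasing_hom_def
    by (intro exI[of _ "\<lambda>V. concat (map f V)"]) auto
qed

definition bounded_instance :: "'a list \<Rightarrow> 'a \<Rightarrow> nat \<Rightarrow> 'b list \<Rightarrow> bool" where
  "bounded_instance V x k U \<longleftrightarrow>
     (\<exists>f. (\<forall>y. f y \<noteq> []) \<and> (\<forall>y\<in>set V - {x}. length (f y) \<le> k) \<and> U = concat (map f V))"

text \<open>Asymptotically, up to an arbitrarily small probability, instances have bounded images outside
  \<open>x\<close>. The bound \<open>k\<close> may depend on \<open>\<epsilon>\<close> but not on the length of the word.\<close>
definition bounded_suffices :: "nat \<Rightarrow> 'a list \<Rightarrow> 'a \<Rightarrow> bool" where
  "bounded_suffices q V x \<longleftrightarrow>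
     (\<forall>\<epsilon>>0. \<exists>k N. \<forall>n\<ge>N.
        measure_pmf.prob (random_word q n) {W. is_instance V W \<and> \<not> bounded_instance V x k W} \<le> \<epsilon>)"

lemma length_concat_map_le:
  assumes "\<And>y. y \<in> set V \<Longrightarrow> length (f y) \<le> m"
  shows "length (concat (map f V)) \<le> length V * m"
  using assms
proof (induction V)
  case (Cons a V)
  have "length (f a) \<le> m" "length (concat (map f V)) \<le> length V * m"
    using Cons by auto
  then show ?case by simp
qed simp

section \<open>Uniformly random words\<close>
lemma finite_words: "finite (words q n)"
  unfolding words_def by (rule finite_lists_length_eq) simp

lemma card_words: "card (words q n) = q ^ n"
  unfolding words_def by (subst card_lists_length_eq) simp_all

lemma words_nonempty: "q > 0 \<Longrightarrow> words q n \<noteq> {}"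
  using card_words[of q n] by force

lemma prob_random_word:
  assumes "q > 0"
  shows "measure_pmf.prob (random_word q n) A = real (card (words q n \<inter> A)) / real q ^ n"
  unfolding random_word_def
  by (subst measure_pmf_of_set[OF words_nonempty[OF assms] finite_words])
     (simp add: card_words)

lemma set_random_word: "q > 0 \<Longrightarrow> set_pmf (random_word q n) = words q n"
  unfolding random_word_def by (simp add: finite_words words_nonempty)

lemma prob_random_word_mono:
  assumes "q > 0" "\<And>W. W \<in> words q n \<Longrightarrow> W \<in> A \<Longrightarrow> W \<in> B"
  shows "measure_pmf.prob (random_word q n) A \<le> measure_pmf.prob (random_word q n) B"
proof -
  have "card (words q n \<inter> A) \<le> card (words q n \<inter> B)"
    using assms(2) by (intro card_mono) (auto simp: finite_words)
  then show ?thesis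
    using assms(1) by (simp add: prob_random_word divide_right_mono)
qed

text \<open>Splitting a uniformly random word at a fixed position gives two independent uniformly random
  words, because concatenation is a bijection.\<close>
lemma prob_random_word_append:
  assumes "q > 0"
  shows "measure_pmf.prob (random_word q (a + b)) {W. take a W \<in> A \<and> drop a W \<in> B}
         = measure_pmf.prob (random_word q a) A * measure_pmf.prob (random_word q b) B"
proof -
  have "bij_betw (\<lambda>(u, v). u @ v) ((words q a \<inter> A) \<times> (words q b \<inter> B))
          (words q (a + b) \<inter> {W. take a W \<in> A \<and> drop a W \<in> B})"
    by (rule bij_betw_byWitness[where f' = "\<lambda>W. (take a W, drop a W)"])
       (auto simp: words_def simp del: atLeastAtMost_iff One_nat_def
          dest: in_set_takeD in_set_dropD)
  then have "card (words q (a + b) \<inter> {W. take a W \<in> A \<and> drop a W \<in> B})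
      = card (words q a \<inter> A) * card (words q b \<inter> B)"
    by (simp add: bij_betw_same_card[symmetric] card_cartesian_product)
  then show ?thesis
    using assms by (simp add: prob_random_word power_add)
qed

lemma prob_random_word_factor:
  assumes "q > 0" "i + m \<le> n"
  shows "measure_pmf.prob (random_word q n) {W. factor W i (i + m) \<in> A}
         = measure_pmf.prob (random_word q m) A"
proof -
  obtain r where r: "n = i + (m + r)"
    using assms(2) by (metis add.assoc le_Suc_ex)
  have 1: "measure_pmf.prob (random_word q n) {W. factor W i (i + m) \<in> A}
      = measure_pmf.prob (random_word q (i + (m + r)))
          {W. take i W \<in> UNIV \<and> drop i W \<in> {Z. take m Z \<in> A \<and> drop m Z \<in> UNIV}}"
    by (simp add: r factor_def)
  show ?thesis
    unfolding 1 prob_random_word_append[OF assms(1)] by simp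
qed

lemma prob_random_word_rev:
  assumes "q > 0"
  shows "measure_pmf.prob (random_word q n) {W. rev W \<in> A} = measure_pmf.prob (random_word q n) A"
proof -
  have "bij_betw rev (words q n \<inter> {W. rev W \<in> A}) (words q n \<inter> A)"
    by (rule bij_betw_byWitness[where f' = rev]) (auto simp: words_def)
  then show ?thesis
    using assms by (simp add: prob_random_word bij_betw_same_card)
qed

text \<open>A word that avoids \<open>u\<close> differs from \<open>u\<close> in each of its \<open>t\<close> disjoint blocks of length \<open>K\<close>, and
  these blocks are independent.\<close>
lemma prob_avoids_word_le:
  assumes "q > 0" "u \<in> words q K"
  shows "measure_pmf.prob (random_word q (K * t)) {W. \<not> (\<exists>a b. W = a @ u @ b)} \<le> (1 - 1 / real q ^ K) ^ t"
proof (induction t)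
  case 0
  then show ?case by simp
next
  case (Suc t)
  have "words q K \<inter> (- {u}) = words q K - {u}" by auto
  then have card: "card (words q K \<inter> (- {u})) = q ^ K - 1"
    using assms(2) by (simp add: card_words finite_words)
  have "measure_pmf.prob (random_word q K) (- {u}) = (real q ^ K - 1) / real q ^ K"
    using assms(1) by (simp add: prob_random_word card of_nat_diff)
  then have one: "measure_pmf.prob (random_word q K) (- {u}) = 1 - 1 / real q ^ K"
    using assms(1) by (simp add: diff_divide_distrib)
  have "measure_pmf.prob (random_word q (K * Suc t)) {W. \<not> (\<exists>a b. W = a @ u @ b)}
      \<le> measure_pmf.prob (random_word q (K + K * t))
          {W. take K W \<in> - {u} \<and> drop K W \<in> {W. \<not> (\<exists>a b. W = a @ u @ b)}}"
    unfolding mult_Suc_right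
  proof (rule prob_random_word_mono[OF assms(1)])
    fix W assume "W \<in> {W. \<not> (\<exists>a b. W = a @ u @ b)}"
    then have avoid: "W \<noteq> a @ u @ b" for a b by blast
    have "take K W \<noteq> u"
      using avoid[of "[]" "drop K W"] by (metis append_Nil append_take_drop_id)
    moreover have "drop K W \<noteq> a @ u @ b" for a b
      using avoid[of "take K W @ a" b] by (metis append.assoc append_take_drop_id)
    ultimately show "W \<in> {W. take K W \<in> - {u} \<and> drop K W \<in> {W. \<not> (\<exists>a b. W = a @ u @ b)}}"
      by blast
  qed
  also have "\<dots> = (1 - 1 / real q ^ K) *
      measure_pmf.prob (random_word q (K * t)) {W. \<not> (\<exists>a b. W = a @ u @ b)}"
    unfolding prob_random_word_append[OF assms(1)] one ..
  also have "\<dots> \<le> (1 - 1 / real q ^ K) * (1 - 1 / real q ^ K) ^ t"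
    using Suc assms(1) by (intro mult_left_mono) (auto simp: one[symmetric])
  finally show ?case by simp
qed

text \<open>The union bound over all words of length \<open>K\<close> gives uniformity in the word that is sought. This
  matters since that word will itself depend on the random word.\<close>
lemma prob_misses_some_word_tendsto_0:
  assumes "q > 0"
  shows "(\<lambda>t. measure_pmf.prob (random_word q (K * t)) {W. \<exists>u\<in>words q K. \<not> (\<exists>a b. W = a @ u @ b)})
           \<longlonglongrightarrow> 0"
proof (rule tendsto_sandwich[OF _ _ tendsto_const])
  show "\<forall>\<^sub>F t in sequentially. measure_pmf.prob (random_word q (K * t))
      {W. \<exists>u\<in>words q K. \<not> (\<exists>a b. W = a @ u @ b)} \<le> real q ^ K * (1 - 1 / real q ^ K) ^ t"
  proof (rule always_eventually, rule allI)
    fix t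
    have "measure_pmf.prob (random_word q (K * t)) {W. \<exists>u\<in>words q K. \<not> (\<exists>a b. W = a @ u @ b)}
       = measure_pmf.prob (random_word q (K * t)) (\<Union>u\<in>words q K. {W. \<not> (\<exists>a b. W = a @ u @ b)})"
      by (rule arg_cong[where f = "measure_pmf.prob _"]) auto
    also have "\<dots> \<le> (\<Sum>u\<in>words q K. measure_pmf.prob (random_word q (K * t)) {W. \<not> (\<exists>a b. W = a @ u @ b)})"
      by (rule measure_pmf.finite_measure_subadditive_finite) (auto simp: finite_words)
    also have "\<dots> \<le> (\<Sum>u\<in>words q K. (1 - 1 / real q ^ K) ^ t)"
      by (intro sum_mono prob_avoids_word_le assms)
    finally show "measure_pmf.prob (random_word q (K * t)) {W. \<exists>u\<in>words q K. \<not> (\<exists>a b. W = a @ u @ b)}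
        \<le> real q ^ K * (1 - 1 / real q ^ K) ^ t"
      by (simp add: card_words)
  qed
  have "(\<lambda>t. (1 - 1 / real q ^ K) ^ t) \<longlonglongrightarrow> 0"
    using assms by (intro LIMSEQ_realpow_zero) auto
  then show "(\<lambda>t. real q ^ K * (1 - 1 / real q ^ K) ^ t) \<longlonglongrightarrow> 0"
    by (rule tendsto_mult_right_zero)
qed simp_all

section \<open>Words with a single nonrecurring letter\<close>

text \<open>If two disjoint factors agree, then the word can be recovered after the second one is deleted,
  so that there are at most \<open>q ^ (n - m)\<close> such words.\<close>
lemma prob_repeated_factor_le:
  assumes "q > 0" "i + m \<le> j" "j + m \<le> n"
  shows "measure_pmf.prob (random_word q n) {W. factor W i (i + m) = factor W j (j + m)} \<le> 1 / real q ^ m"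
proof -
  let ?E = "words q n \<inter> {W. factor W i (i + m) = factor W j (j + m)}"
  have split: "W = take j W @ take m (drop i (take j W)) @ drop (j + m) W" if "W \<in> ?E" for W
  proof -
    have "take m (drop i (take j W)) = factor W i (i + m)"
      using assms by (simp add: factor_def drop_take take_take min_def)
    also have "\<dots> = take m (drop j W)"
      using that by (simp add: factor_def)
    finally show ?thesis
      by (metis append_take_drop_id drop_drop add.commute)
  qed
  have "inj_on (\<lambda>W. (take j W, drop (j + m) W)) ?E"
  proof (rule inj_onI)
    fix W W' assume "W \<in> ?E" "W' \<in> ?E" "(take j W, drop (j + m) W) = (take j W', drop (j + m) W')"
    then show "W = W'" using split[of W] split[of W'] by simp
  qed
  then have "card ?E = card ((\<lambda>W. (take j W, drop (j + m) W)) ` ?E)"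
    by (rule card_image[symmetric])
  also have "\<dots> \<le> card (words q j \<times> words q (n - (j + m)))"
    using assms(3) by (intro card_mono finite_cartesian_product finite_words)
      (auto simp: words_def simp del: atLeastAtMost_iff One_nat_def
            dest: in_set_takeD in_set_dropD)
  also have "\<dots> = q ^ (n - m)"
    using assms(3) by (simp add: card_cartesian_product card_words power_add[symmetric])
  finally have "real (card ?E) \<le> real q ^ (n - m)"
    by (metis of_nat_le_iff of_nat_power)
  moreover have "real q ^ n = real q ^ (n - m) * real q ^ m"
    using assms(3) by (simp add: power_add[symmetric])
  ultimately show ?thesis
    using assms(1) by (simp add: prob_random_word divide_simps)
qed

text \<open>The positions in a word of length \<open>n\<close> at distance at most \<open>r\<close> from one of its ends.\<close>
definition near_ends :: "nat \<Rightarrow> nat \<Rightarrow> nat set" where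
  "near_ends r n = {..r} \<union> {n - r..n}"

lemma finite_near_ends: "finite (near_ends r n)"
  by (simp add: near_ends_def)

lemma card_near_ends_le: "card (near_ends r n) \<le> 2 * (r + 1)"
proof -
  have "card (near_ends r n) \<le> card {..r} + card {n - r..n}"
    unfolding near_ends_def by (rule card_Un_le)
  then show ?thesis by simp
qed

text \<open>Either \<open>A\<close> or \<open>B\<close> is free of \<open>x\<close>, and the image of that part is short. The position where the
  two images meet is thus close to the left end or to the right end, however long the image of \<open>x\<close> is.\<close>
lemma prefix_image_ends_near_ends:
  assumes "V = A @ B" "count_list V x = 1"
    and le: "\<And>y. y \<in> set V - {x} \<Longrightarrow> length (f y) \<le> m"
  shows "length (concat (map f A)) \<in> near_ends (length V * m) (length (concat (map f V)))"
proof (cases "x \<in> set A")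
  case False
  then have "length (concat (map f A)) \<le> length A * m"
    using assms(1) by (intro length_concat_map_le le) auto
  also have "\<dots> \<le> length V * m" using assms(1) by simp
  finally show ?thesis by (simp add: near_ends_def)
next
  case True
  then have "count_list A x > 0" by (simp add: count_list_0_iff gr0_conv_Suc[symmetric] neq0_conv[symmetric] del: neq0_conv)
  then have "count_list B x = 0" using assms by simp
  then have "x \<notin> set B" by (simp add: count_list_0_iff)
  then have "length (concat (map f B)) \<le> length B * m"
    using assms(1) by (intro length_concat_map_le le) auto
  also have "\<dots> \<le> length V * m" using assms(1) by simp
  finally show ?thesis using assms(1) by (auto simp: near_ends_def)
qed

lemma repeated_letter_gives_repeated_factor:
  assumes x: "count_list V x = 1" and y: "count_list V y \<ge> 2"
    and W: "W = concat (map f V)"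
    and le: "\<And>z. z \<in> set V - {x} \<Longrightarrow> length (f z) \<le> length (f y)"
  defines "m \<equiv> length (f y)"
  shows "\<exists>i\<in>near_ends (length V * m) (length W). \<exists>j\<in>near_ends (length V * m) (length W).
           i + m \<le> j \<and> j + m \<le> length W \<and> factor W i (i + m) = factor W j (j + m)"
proof -
  have "y \<in> set V" using y count_list_0_iff[of V y] by force
  then obtain A R where AR: "V = A @ y # R" "y \<notin> set A"
    by (metis split_list_first)
  then have "count_list R y \<noteq> 0" using y by simp
  then have "y \<in> set R" by (simp add: count_list_0_iff)
  then obtain B C where V: "V = A @ y # B @ y # C"
    using AR(1) by (metis split_list)
  let ?i = "length (concat (map f A))" and ?j = "length (concat (map f (A @ y # B)))"
  have "?i \<in> near_ends (length V * m) (length W)" "?j \<in> near_ends (length V * m) (length W)"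
    unfolding W m_def
    by (rule prefix_image_ends_near_ends[OF _ x le, where B = "y # B @ y # C"]
          prefix_image_ends_near_ends[OF _ x le, where B = "y # C"]; simp add: V)+
  moreover have "?i + m \<le> ?j" "?j + m \<le> length W"
    by (simp_all add: V W m_def)
  moreover have "factor W ?i (?i + m) = f y" "factor W ?j (?j + m) = f y"
    by (simp_all add: V W m_def factor_def)
  ultimately show ?thesis by metis
qed

text \<open>The numerator bounds the number of pairs of positions in the union bound, for \<open>L = |V|\<close>.\<close>
lemma summable_poly_times_geometric:
  assumes "q \<ge> 2"
  shows "summable (\<lambda>m. real (2 * (L * m + 1)) ^ 2 / real q ^ m)"
proof (rule summable_comparison_test_bigo)
  show "summable (\<lambda>m. norm (inverse (real m ^ 2)))"
    using inverse_power_summable[of 2, where 'a = real] by simp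
  have "real (2 * (L * m + 1)) ^ 2 / real q ^ m \<le> real (2 * (L + 1)) ^ 2 * ((real m + 1) ^ 2 / 2 ^ m)" for m
  proof -
    have "real (2 * (L * m + 1)) \<le> real (2 * (L + 1)) * (real m + 1)"
      by (simp add: algebra_simps)
    then have "real (2 * (L * m + 1)) ^ 2 \<le> (real (2 * (L + 1)) * (real m + 1)) ^ 2"
      by (rule power_mono) simp
    then have "real (2 * (L * m + 1)) ^ 2 / real q ^ m \<le> (real (2 * (L + 1)) * (real m + 1)) ^ 2 / 2 ^ m"
      using assms by (intro frac_le) (auto intro!: power_mono)
    then show ?thesis by (simp add: power_mult_distrib)
  qed
  then have "(\<lambda>m. real (2 * (L * m + 1)) ^ 2 / real q ^ m) \<in> O(\<lambda>m. (real m + 1) ^ 2 / 2 ^ m)"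
    by (intro bigoI[of _ "real (2 * (L + 1)) ^ 2"] always_eventually) simp
  also have "(\<lambda>m. (real m + 1) ^ 2 / 2 ^ m) \<in> O(\<lambda>m. inverse (real m ^ 2))"
    by real_asymp
  finally show "(\<lambda>m. real (2 * (L * m + 1)) ^ 2 / real q ^ m) \<in> O(\<lambda>m. inverse (real m ^ 2))" .
qed

text \<open>Taking a letter \<open>y \<noteq> x\<close> with the longest image makes \<open>m = |f y|\<close> bound all images outside \<open>x\<close>.
  The repeated factor thus starts at positions within \<open>|V| m\<close> of the ends. Their number does not
  depend on \<open>n\<close>, and this is what makes the bound uniform in \<open>n\<close>.\<close>
lemma prob_unbounded_instance_le:
  assumes q: "q > 0" and x: "count_list V x = 1"
    and others: "\<And>y. y \<in> set V - {x} \<Longrightarrow> count_list V y \<ge> 2"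
  shows "measure_pmf.prob (random_word q n) {W. is_instance V W \<and> \<not> bounded_instance V x k W}
         \<le> (\<Sum>m=Suc k..<Suc n. real (2 * (length V * m + 1)) ^ 2 / real q ^ m)"
proof -
  let ?P = "measure_pmf.prob (random_word q n)"
  let ?Rep = "\<lambda>m i j. {W. factor W i (i + m) = factor W j (j + m)}"
  let ?I = "\<lambda>m. {(i, j). i \<in> near_ends (length V * m) n \<and> j \<in> near_ends (length V * m) n \<and>
                   i + m \<le> j \<and> j + m \<le> n}"
  have I_sub: "?I m \<subseteq> near_ends (length V * m) n \<times> near_ends (length V * m) n" for m
    by auto
  have fin: "finite (?I m)" for m
    by (rule finite_subset[OF I_sub]) (simp add: finite_near_ends)
  have "card (?I m) \<le> card (near_ends (length V * m) n \<times> near_ends (length V * m) n)" for m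
    by (intro card_mono I_sub) (simp add: finite_near_ends)
  also have "card (near_ends (length V * m) n \<times> near_ends (length V * m) n)
      \<le> (2 * (length V * m + 1)) ^ 2" for m
    unfolding card_cartesian_product power2_eq_square by (intro mult_mono card_near_ends_le) auto
  finally have card_I: "real (card (?I m)) \<le> real (2 * (length V * m + 1)) ^ 2" for m
    by (simp only: of_nat_le_iff of_nat_power[symmetric])
  have "?P {W. is_instance V W \<and> \<not> bounded_instance V x k W}
      \<le> ?P (\<Union>m\<in>{Suc k..<Suc n}. \<Union>(i, j)\<in>?I m. ?Rep m i j)"
  proof (rule prob_random_word_mono[OF q])
    fix W assume "W \<in> words q n" and "W \<in> {W. is_instance V W \<and> \<not> bounded_instance V x k W}"
    then have len: "length W = n" and unb: "\<not> bounded_instance V x k W" and "is_instance V W"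
      by (auto simp: words_def)
    then obtain f where f: "\<forall>y. f y \<noteq> []" "W = concat (map f V)"
      by (auto simp: is_instance_iff_subst)
    have "\<not> (\<forall>y\<in>set V - {x}. length (f y) \<le> k)"
      using unb f unfolding bounded_instance_def by blast
    then obtain y0 where y0: "y0 \<in> set V - {x}" "length (f y0) > k"
      by force
    obtain y where y: "y \<in> set V - {x}" "\<And>z. z \<in> set V - {x} \<Longrightarrow> length (f z) \<le> length (f y)"
      using ex_has_greatest_nat[of "\<lambda>z. z \<in> set V - {x}" y0 "length \<circ> f" "Suc (Max ((length \<circ> f) ` (set V - {x})))"] y0(1)
      by (auto simp: less_Suc_eq_le)
    have "length (f y) > k" using y(2)[OF y0(1)] y0(2) by simp
    moreover obtain i j where ij: "i \<in> near_ends (length V * length (f y)) n"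
        "j \<in> near_ends (length V * length (f y)) n"
        "i + length (f y) \<le> j" "j + length (f y) \<le> n" "W \<in> ?Rep (length (f y)) i j"
      using repeated_letter_gives_repeated_factor[OF x others[OF y(1)] f(2) y(2)] len by blast
    ultimately show "W \<in> (\<Union>m\<in>{Suc k..<Suc n}. \<Union>(i, j)\<in>?I m. ?Rep m i j)"
      by (intro UN_I[of "length (f y)"] UN_I[of "(i, j)"]) auto
  qed
  also have "\<dots> \<le> (\<Sum>m=Suc k..<Suc n. ?P (\<Union>(i, j)\<in>?I m. ?Rep m i j))"
    by (rule measure_pmf.finite_measure_subadditive_finite) auto
  also have "\<dots> \<le> (\<Sum>m=Suc k..<Suc n. \<Sum>(i, j)\<in>?I m. ?P (?Rep m i j))"
    unfolding case_prod_beta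
    by (intro sum_mono measure_pmf.finite_measure_subadditive_finite) (auto simp: fin[unfolded case_prod_beta])
  also have "\<dots> \<le> (\<Sum>m=Suc k..<Suc n. \<Sum>(i, j)\<in>?I m. 1 / real q ^ m)"
    by (intro sum_mono) (auto intro!: prob_repeated_factor_le q)
  also have "\<dots> = (\<Sum>m=Suc k..<Suc n. real (card (?I m)) / real q ^ m)"
    by (simp add: case_prod_beta)
  also have "\<dots> \<le> (\<Sum>m=Suc k..<Suc n. real (2 * (length V * m + 1)) ^ 2 / real q ^ m)"
    by (intro sum_mono divide_right_mono card_I) simp
  finally show ?thesis .
qed

lemma bounded_suffices_single_nonrecurring:
  assumes q: "q \<ge> 2" and x: "count_list V x = 1"
    and others: "\<And>y. y \<in> set V - {x} \<Longrightarrow> count_list V y \<ge> 2"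
  shows "bounded_suffices q V x"
  unfolding bounded_suffices_def
proof (intro allI impI)
  fix \<epsilon> :: real assume "\<epsilon> > 0"
  then obtain k where k: "\<And>m n. m \<ge> k \<Longrightarrow>
      norm (\<Sum>m=m..<n. real (2 * (length V * m + 1)) ^ 2 / real q ^ m) < \<epsilon>"
    using summable_poly_times_geometric[OF q, of "length V"] unfolding summable_Cauchy by blast
  have "measure_pmf.prob (random_word q n) {W. is_instance V W \<and> \<not> bounded_instance V x k W} \<le> \<epsilon>" for n
    using prob_unbounded_instance_le[OF _ x others, of q n k] k[of "Suc k" "Suc n"] q by auto
  then show "\<exists>k N. \<forall>n\<ge>N. measure_pmf.prob (random_word q n)
      {W. is_instance V W \<and> \<not> bounded_instance V x k W} \<le> \<epsilon>" by blast
qed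

text \<open>Over one letter the series above diverges. But the only word of length \<open>n\<close> is then \<open>1\<^sup>n\<close>, and
  it is an instance as soon as \<open>n \<ge> |V|\<close>, with all letters but \<open>x\<close> mapped to single letters.\<close>
lemma bounded_suffices_unary:
  assumes x: "count_list V x = 1"
  shows "bounded_suffices 1 V x"
proof -
  obtain A B where V: "V = A @ x # B"
    using x count_list_0_iff[of V x] by (metis split_list zero_neq_one)
  then have xAB: "x \<notin> set A" "x \<notin> set B" using x by (auto simp: count_list_0_iff)
  have "bounded_instance V x 1 W" if W1: "W \<in> words 1 n" and inst: "is_instance V W" for W n
  proof -
    have W: "W = replicate (length W) 1"
      using W1 by (intro replicate_eqI) (auto simp: words_def)
    obtain f where f: "\<forall>y. f y \<noteq> []" "W = concat (map f V)"
      using inst by (auto simp: is_instance_iff_subst)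
    have "length (concat (map f V)) \<ge> length V"
    proof (induction V)
      case (Cons a V)
      have "length (f a) > 0" using f(1) by simp
      moreover have "length V \<le> length (concat (map f V))" by (fact Cons)
      ultimately show ?case
        unfolding list.map concat.simps length_append list.size by linarith
    qed simp
    then have len: "length W \<ge> length V" using f by simp
    define g where "g = (\<lambda>y. if y = x then replicate (Suc (length W - length V)) (1::nat) else [1])"
    have ones: "concat (map g C) = replicate (length C) 1" if "x \<notin> set C" for C
      using that by (induction C) (auto simp: g_def)
    have "concat (map g V) = concat (map g A) @ g x @ concat (map g B)"
      by (simp add: V)
    also have "\<dots> = replicate (length A) 1 @ replicate (Suc (length W - length V)) 1 @ replicate (length B) 1"
      unfolding ones[OF xAB(1)] ones[OF xAB(2)] by (simp add: g_def)
    also have "\<dots> = replicate (length A + Suc (length W - length V) + length B) 1"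
      by (simp only: replicate_add append_assoc)
    also have "length A + Suc (length W - length V) + length B = length W"
      using len by (simp add: V)
    finally have "W = concat (map g V)" using W by simp
    then show ?thesis unfolding bounded_instance_def
      by (intro exI[of _ g]) (auto simp: g_def)
  qed
  then have le: "measure_pmf.prob (random_word 1 n) {W. is_instance V W \<and> \<not> bounded_instance V x 1 W}
      \<le> measure_pmf.prob (random_word 1 n) {}" for n
    by (intro prob_random_word_mono) auto
  have "measure_pmf.prob (random_word 1 n) {W. is_instance V W \<and> \<not> bounded_instance V x 1 W} \<le> \<epsilon>"
    if "\<epsilon> > 0" for \<epsilon> n
    by (rule order_trans[OF le]) (use that in simp)
  then show ?thesis
    unfolding bounded_suffices_def by blast
qed

section \<open>Merging nonrecurring letters\<close>
lemma bounded_instance_rev: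
  "bounded_instance (rev V) x k (rev W) \<longleftrightarrow> bounded_instance V x k W"
proof -
  have *: "bounded_instance (rev V) x k (rev W)" if "bounded_instance V x k W" for V :: "'a list" and W :: "'b list"
  proof -
    obtain f where "\<forall>y. f y \<noteq> []" "\<forall>y\<in>set V - {x}. length (f y) \<le> k" "W = concat (map f V)"
      using \<open>bounded_instance V x k W\<close> by (auto simp: bounded_instance_def)
    then show ?thesis
      unfolding bounded_instance_def
      by (intro exI[of _ "rev \<circ> f"]) (auto simp: rev_concat rev_map)
  qed
  show ?thesis using *[of V W] *[of "rev V" "rev W"] by auto
qed

lemma is_instance_rev: "is_instance (rev V) (rev W) \<longleftrightarrow> is_instance V W"
proof -
  have *: "is_instance (rev V) (rev W)" if "is_instance V W" for V :: "'a list" and W :: "'b list"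
  proof -
    obtain f where "\<forall>y. f y \<noteq> []" "W = concat (map f V)"
      using \<open>is_instance V W\<close> by (auto simp: is_instance_iff_subst)
    then show ?thesis
      unfolding is_instance_iff_subst
      by (intro exI[of _ "rev \<circ> f"]) (auto simp: rev_concat rev_map)
  qed
  show ?thesis using *[of V W] *[of "rev V" "rev W"] by auto
qed

lemma bounded_suffices_rev:
  assumes "q > 0" "bounded_suffices q (rev V) x"
  shows "bounded_suffices q V x"
proof -
  have "measure_pmf.prob (random_word q n) {W. is_instance V W \<and> \<not> bounded_instance V x k W}
     = measure_pmf.prob (random_word q n) {W. is_instance (rev V) W \<and> \<not> bounded_instance (rev V) x k W}" for n k
    using prob_random_word_rev[OF assms(1), of n
        "{W. is_instance (rev V) W \<and> \<not> bounded_instance (rev V) x k W}"]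
    by (simp add: bounded_instance_rev is_instance_rev)
  then show ?thesis using assms(2) by (simp add: bounded_suffices_def)
qed

lemma append_middle_extends:
  assumes "L @ M @ R = a @ X @ b" "length a \<le> length L" "length b \<le> length R"
  shows "\<exists>L' R'. L = a @ L' \<and> R = R' @ b \<and> X = L' @ M @ R'"
proof -
  have "take (length a) L = a"
    using arg_cong[OF assms(1), of "take (length a)"] assms(2) by simp
  then have L: "L = a @ drop (length a) L"
    by (metis append_take_drop_id)
  have "take (length b) (rev R) = rev b"
    using arg_cong[OF assms(1), of "\<lambda>w. take (length b) (rev w)"] assms(3) by simp
  then have "rev R = rev b @ drop (length b) (rev R)"
    by (metis append_take_drop_id)
  then have R: "R = rev (drop (length b) (rev R)) @ b"
    by (metis rev_append rev_rev_ident)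
  define L' R' where "L' = drop (length a) L" and "R' = rev (drop (length b) (rev R))"
  have "L = a @ L'" "R = R' @ b" using L R by (simp_all only: L'_def R'_def)
  then show ?thesis using assms(1) by auto
qed

lemma bounded_instance_mono:
  assumes "bounded_instance V x k W" "k \<le> k'"
  shows "bounded_instance V x k' W"
  using assms order_trans[OF _ assms(2)] unfolding bounded_instance_def by blast

text \<open>As \<open>x\<close> occurs nowhere else, its image is an arbitrary nonempty word \<open>X\<close>, unrelated to the
  images of the other letters.\<close>
lemma bounded_instance_around:
  assumes "x \<notin> set A" "x \<notin> set B"
  shows "bounded_instance (A @ x # B) x k W \<longleftrightarrow>
    (\<exists>f X. (\<forall>y. f y \<noteq> []) \<and> (\<forall>y\<in>set A \<union> set B. length (f y) \<le> k) \<and> X \<noteq> [] \<and>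
       W = concat (map f A) @ X @ concat (map f B))" (is "?l \<longleftrightarrow> ?r")
proof
  assume ?l
  then obtain f where "\<forall>y. f y \<noteq> []" "\<forall>y\<in>set (A @ x # B) - {x}. length (f y) \<le> k"
      "W = concat (map f (A @ x # B))"
    unfolding bounded_instance_def by blast
  then show ?r using assms by (intro exI[of _ f] exI[of _ "f x"]) auto
next
  assume ?r
  then obtain f X where f: "\<forall>y. f y \<noteq> []" "\<forall>y\<in>set A \<union> set B. length (f y) \<le> k" "X \<noteq> []"
      "W = concat (map f A) @ X @ concat (map f B)"
    by blast
  define g where "g = f(x := X)"
  have "map g A = map f A" "map g B = map f B" "g x = X"
    using assms by (auto simp: g_def)
  then have "W = concat (map g (A @ x # B))" using f(4) by (simp del: map_eq_conv)
  moreover have "\<forall>y. g y \<noteq> []" "\<forall>y\<in>set (A @ x # B) - {x}. length (g y) \<le> k"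
    using f(1-3) by (auto simp: g_def)
  ultimately show ?l unfolding bounded_instance_def by blast
qed

text \<open>The new image of \<open>x\<close> is the former image of the whole segment \<open>x Q y\<close>.\<close>
lemma is_instance_merge:
  assumes "is_instance (P @ x # Q @ y # R) W" "x \<notin> set P" "x \<notin> set R"
  shows "is_instance (P @ x # R) W"
proof -
  obtain f where f: "\<forall>z. f z \<noteq> []" "W = concat (map f (P @ x # Q @ y # R))"
    using assms(1) by (auto simp: is_instance_iff_subst)
  define g where "g = f(x := f x @ concat (map f Q) @ f y)"
  have "map g P = map f P" "map g R = map f R" "g x = f x @ concat (map f Q) @ f y"
    using assms by (auto simp: g_def)
  then have "W = concat (map g (P @ x # R))" using f by (simp del: map_eq_conv)
  moreover have "\<forall>z. g z \<noteq> []" using f(1) by (simp add: g_def)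
  ultimately show ?thesis unfolding is_instance_iff_subst by blast
qed

text \<open>A converse to merging. The letters of \<open>P\<close> and \<open>R\<close> keep their images and all remaining letters
  of \<open>Q\<close> are mapped to the single letter \<open>1\<close>. The resulting image of \<open>Q\<close> is shorter than \<open>K\<close>; padded
  to length \<open>K\<close> it occurs in the window \<open>D\<close>. This window lies inside the old image of \<open>x\<close>, because the
  images of \<open>P\<close> and \<open>R\<close> are shorter than \<open>K\<close>. What lies between the image of \<open>P\<close> and this
  occurrence becomes the image of \<open>x\<close>. What follows it, up to the
  image of \<open>R\<close>, becomes the image of \<open>y\<close>; the padding makes it nonempty, and its length is at most
  \<open>K + |D|\<close>.\<close>
lemma bounded_instance_unmerge:
  fixes P Q R :: "'a list"
  assumes x: "x \<notin> set P" "x \<notin> set Q" "x \<notin> set R"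
    and y: "y \<notin> set P" "y \<notin> set Q" "y \<notin> set R" "x \<noteq> y"
    and k: "k \<ge> 1" and q: "q > 0"
    and K: "K > k * length P" "K > k * length Q" "K > k * length R" "K \<ge> k"
    and inst: "bounded_instance (P @ x # R) x k W"
    and W: "W = C @ D @ E" "set W \<subseteq> {1..q}" "length C \<ge> K" "length E = K"
    and D: "\<forall>u\<in>words q K. \<exists>a b. D = a @ u @ b"
  shows "bounded_instance (P @ x # Q @ y # R) x (K + length D) W"
proof -
  obtain f X where f: "\<forall>z. f z \<noteq> []" "\<forall>z\<in>set P \<union> set R. length (f z) \<le> k" "X \<noteq> []"
      "W = concat (map f P) @ X @ concat (map f R)"
    using inst bounded_instance_around[OF x(1,3)] by blast
  have "length (concat (map f P)) \<le> length P * k" "length (concat (map f R)) \<le> length R * k"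
    using f(2) by (auto intro!: length_concat_map_le)
  then have lP: "length (concat (map f P)) < K" and lR: "length (concat (map f R)) < K"
    using K by (simp_all add: mult.commute)
  have "\<exists>C' E'. C = concat (map f P) @ C' \<and> E = E' @ concat (map f R) \<and> X = C' @ D @ E'"
    using W(1,3,4) f(4) lP lR by (intro append_middle_extends) simp_all
  then obtain C' E' where CE: "C = concat (map f P) @ C'" "E = E' @ concat (map f R)"
    by blast
  define h where "h = (\<lambda>z. if z \<in> set P \<union> set R then f z else [1])"
  have h_le: "length (h z) \<le> k" for z using f(2) k by (auto simp: h_def)
  have h_set: "set (h z) \<subseteq> {1..q}" for z
  proof (cases "z \<in> set P \<union> set R")
    case True
    then have "set (f z) \<subseteq> set W" unfolding f(4) by auto
    then show ?thesis using W(2) True by (auto simp: h_def)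
  qed (use q in \<open>auto simp: h_def\<close>)
  have lQ: "length (concat (map h Q)) < K"
    using length_concat_map_le[of Q h k] h_le K(2) by (simp add: mult.commute order_le_less_trans)
  define pad where "pad = replicate (K - length (concat (map h Q))) (1::nat)"
  have one_in: "1 \<in> {1..q}" using q by simp
  have "concat (map h Q) @ pad \<in> words q K"
    using lQ h_set one_in by (auto simp: words_def pad_def simp del: atLeastAtMost_iff One_nat_def)
  then obtain a b where ab: "D = a @ (concat (map h Q) @ pad) @ b"
    using D by blast
  define g where "g = h(x := C' @ a, y := pad @ b @ E')"
  have "C' \<noteq> []" using CE(1) W(3) lP by auto
  moreover have "pad \<noteq> []" using lQ by (simp add: pad_def)
  ultimately have "\<forall>z. g z \<noteq> []" using f(1) by (auto simp: g_def h_def)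
  moreover have "length (g z) \<le> K + length D" if "z \<noteq> x" for z
  proof (cases "z = y")
    case True
    have "length E' \<le> K" using CE(2) W(4) by simp
    then show ?thesis using True ab that by (simp add: g_def)
  next
    case False
    then show ?thesis using that h_le[of z] K(4) by (simp add: g_def)
  qed
  moreover have "W = concat (map g (P @ x # Q @ y # R))"
  proof -
    have "map g P = map f P" "map g R = map f R" "map g Q = map h Q" "g x = C' @ a" "g y = pad @ b @ E'"
      using x y by (auto simp: g_def h_def)
    then show ?thesis by (simp add: W(1) CE ab del: map_eq_conv)
  qed
  ultimately show ?thesis unfolding bounded_instance_def by blast
qed

text \<open>An instance of \<open>P x Q y R\<close> can only fail to be a bounded one if it is an unbounded instance of
  \<open>P x R\<close>, or if a window of fixed length near the right end misses some word of length \<open>K\<close>. Each of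
  these two events gets half of \<open>\<epsilon>\<close>.\<close>
lemma bounded_suffices_unmerge:
  fixes P Q R :: "'a list"
  assumes q: "q > 0"
    and x: "x \<notin> set P" "x \<notin> set Q" "x \<notin> set R"
    and y: "y \<notin> set P" "y \<notin> set Q" "y \<notin> set R" "x \<noteq> y"
    and suff: "bounded_suffices q (P @ x # R) x"
  shows "bounded_suffices q (P @ x # Q @ y # R) x"
  unfolding bounded_suffices_def
proof (intro allI impI)
  fix \<epsilon> :: real assume \<epsilon>: "\<epsilon> > 0"
  let ?V = "P @ x # Q @ y # R"
  obtain k N where kN: "\<And>n. n \<ge> N \<Longrightarrow> measure_pmf.prob (random_word q n)
      {W. is_instance (P @ x # R) W \<and> \<not> bounded_instance (P @ x # R) x k W} \<le> \<epsilon> / 2"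
    using suff half_gt_zero[OF \<epsilon>] unfolding bounded_suffices_def by blast
  \<comment> \<open>\<open>Suc k\<close> instead of \<open>k\<close> leaves room for the letters of \<open>Q\<close> that are mapped to \<open>1\<close>, and the
     second factor makes \<open>K\<close> exceed the lengths of the bounded images of \<open>P\<close>, \<open>Q\<close> and \<open>R\<close>.\<close>
  define K where "K = Suc k * Suc (length P + length Q + length R)"
  have K: "K > Suc k * length P" "K > Suc k * length Q" "K > Suc k * length R" "K \<ge> Suc k"
    unfolding K_def by (simp_all add: algebra_simps)
  let ?Bad = "{W. \<exists>u\<in>words q K. \<not> (\<exists>a b. W = a @ u @ b)}"
  have "\<forall>\<^sub>F t in sequentially. measure_pmf.prob (random_word q (K * t)) ?Bad < \<epsilon> / 2"
    using prob_misses_some_word_tendsto_0[OF q, of K] \<epsilon> by (intro order_tendstoD) auto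
  then obtain t where t: "measure_pmf.prob (random_word q (K * t)) ?Bad < \<epsilon> / 2"
    by (auto simp: eventually_sequentially)
  define M where "M = K * t"
  have "measure_pmf.prob (random_word q n) {W. is_instance ?V W \<and> \<not> bounded_instance ?V x (K + M) W} \<le> \<epsilon>"
    if n: "n \<ge> max N (2 * K + M)" for n
  proof -
    have n': "2 * K + M \<le> n" using n by simp
    let ?i = "n - K - M"
    let ?A = "{W. is_instance (P @ x # R) W \<and> \<not> bounded_instance (P @ x # R) x k W}"
    let ?B = "{W. factor W ?i (?i + M) \<in> ?Bad}"
    have "measure_pmf.prob (random_word q n) {W. is_instance ?V W \<and> \<not> bounded_instance ?V x (K + M) W}
        \<le> measure_pmf.prob (random_word q n) (?A \<union> ?B)"
    proof (rule prob_random_word_mono[OF q], rule ccontr)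
      fix W assume W: "W \<in> words q n" and "W \<in> {W. is_instance ?V W \<and> \<not> bounded_instance ?V x (K + M) W}"
        and not: "W \<notin> ?A \<union> ?B"
      then have inst: "is_instance ?V W" and unb: "\<not> bounded_instance ?V x (K + M) W"
        by blast+
      have "bounded_instance (P @ x # R) x k W"
        using is_instance_merge[OF inst x(1,3)] not by blast
      then have b: "bounded_instance (P @ x # R) x (Suc k) W"
        by (rule bounded_instance_mono) simp
      let ?D = "factor W ?i (?i + M)"
      have len: "length W = n" and set: "set W \<subseteq> {1..q}" using W by (auto simp: words_def)
      have W_eq: "W = take ?i W @ ?D @ drop (?i + M) W"
        unfolding factor_def by (simp add: drop_drop[symmetric] add.commute[of _ M] del: drop_drop)
      have good: "\<forall>u\<in>words q K. \<exists>a b. ?D = a @ u @ b" using not by blast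
      have C: "K \<le> length (take ?i W)" and E: "length (drop (?i + M) W) = K" and D: "length ?D = M"
        using n' len by (simp_all add: factor_def)
      have "bounded_instance ?V x (K + length ?D) W"
        by (rule bounded_instance_unmerge[OF x y _ q K b W_eq set C E good]) simp
      then have "bounded_instance ?V x (K + M) W" by (simp only: D)
      then show False using unb by blast
    qed
    also have "\<dots> \<le> measure_pmf.prob (random_word q n) ?A + measure_pmf.prob (random_word q n) ?B"
      by (rule measure_Un_le) auto
    also have "measure_pmf.prob (random_word q n) ?B = measure_pmf.prob (random_word q M) ?Bad"
      using n by (intro prob_random_word_factor q) auto
    finally show ?thesis using t kN[of n] n by (simp add: M_def)
  qed
  then show "\<exists>k N. \<forall>n\<ge>N. measure_pmf.prob (random_word q n)
      {W. is_instance ?V W \<and> \<not> bounded_instance ?V x k W} \<le> \<epsilon>" by blast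
qed

lemma bounded_suffices_nonrecurring:
  assumes "q > 0" "count_list V x = 1"
  shows "bounded_suffices q V x"
  using assms(2)
proof (induction "length V" arbitrary: V rule: less_induct)
  case less
  \<comment> \<open>This is stated for a second word \<open>U\<close> because it is needed for \<open>V\<close> and for \<open>rev V\<close>.\<close>
  have step: "bounded_suffices q U x"
    if U: "length U = length V" "U = P @ x # Q @ y # R" "count_list U x = 1" "count_list U y = 1" "y \<noteq> x"
    for U P Q R y
  proof -
    have "x \<notin> set P \<union> set Q \<union> set R" "y \<notin> set P \<union> set Q \<union> set R"
      using U(2-5) by (auto simp: count_list_0_iff[symmetric])
    moreover have "bounded_suffices q (P @ x # R) x"
      using calculation U by (intro less.hyps) (auto simp: U(1)[symmetric] count_list_0_iff)
    ultimately show ?thesis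
      unfolding U(2) using assms(1) U(5) by (intro bounded_suffices_unmerge) auto
  qed
  show ?case
  proof (cases "\<exists>y. y \<noteq> x \<and> count_list V y = 1")
    case False
    have others: "count_list V y \<ge> 2" if "y \<in> set V - {x}" for y
    proof -
      have "count_list V y \<noteq> 0" "count_list V y \<noteq> 1"
        using that False by (auto simp: count_list_0_iff)
      then show ?thesis by simp
    qed
    show ?thesis
    proof (cases "q = 1")
      case True
      then show ?thesis using bounded_suffices_unary[OF less.prems] by simp
    next
      case False
      then show ?thesis
        using assms(1) less.prems others by (intro bounded_suffices_single_nonrecurring) auto
    qed
  next
    case True
    then obtain y where y: "y \<noteq> x" "count_list V y = 1" by blast
    have "x \<in> set V" "y \<in> set V"
      using less.prems y count_list_0_iff[of V] by (metis zero_neq_one)+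
    then obtain P T where V: "V = P @ x # T" by (meson split_list)
    show ?thesis
    proof (cases "y \<in> set T")
      case True
      then obtain Q R where "T = Q @ y # R" by (meson split_list)
      then show ?thesis using V y less.prems by (intro step) auto
    next
      case False
      then have "y \<in> set P" using \<open>y \<in> set V\<close> V y by auto
      then obtain R' Q' where P: "P = R' @ y # Q'" by (meson split_list)
      have "bounded_suffices q (rev V) x"
        using V P y less.prems by (intro step[of _ "rev T" "rev Q'" y "rev R'"]) (auto simp: add.commute)
      then show ?thesis by (rule bounded_suffices_rev[OF assms(1)])
    qed
  qed
qed

section \<open>Convergence of the instance probabilities\<close>

text \<open>The inserted letter falls within the image of \<open>x\<close>. The strict bound on \<open>R\<close> ensures that this
  image remains nonempty when the letter is deleted again.\<close>
lemma bounded_instance_insert_iff: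
  assumes x: "count_list V x = 1" and L: "length L \<ge> k * length V" and R: "length R > k * length V"
  shows "bounded_instance V x k (L @ c # R) \<longleftrightarrow> bounded_instance V x k (L @ R)"
proof -
  have "x \<in> set V" using x count_list_0_iff[of V x] by auto
  then obtain A B where V: "V = A @ x # B" by (meson split_list)
  then have xAB: "x \<notin> set A" "x \<notin> set B" using x by (auto simp: count_list_0_iff)
  have transfer: "bounded_instance V x k (L @ M' @ R)" if inst: "bounded_instance V x k (L @ M @ R)" for M M'
  proof -
    obtain f X where f: "\<forall>y. f y \<noteq> []" "\<forall>y\<in>set A \<union> set B. length (f y) \<le> k"
        "L @ M @ R = concat (map f A) @ X @ concat (map f B)"
      using inst unfolding V bounded_instance_around[OF xAB] by blast
    have "length (concat (map f A)) \<le> length A * k" "length (concat (map f B)) \<le> length B * k"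
      using f(2) by (auto intro!: length_concat_map_le)
    moreover have "k * length V = length A * k + k + length B * k"
      by (simp add: V algebra_simps)
    ultimately have le: "length (concat (map f A)) \<le> length L" "length (concat (map f B)) < length R"
      using L R by linarith+
    obtain L' R' where LR: "L = concat (map f A) @ L'" "R = R' @ concat (map f B)"
      using append_middle_extends[OF f(3) le(1) less_imp_le[OF le(2)]] by blast
    have "R' \<noteq> []" using LR(2) le(2) by auto
    then have "L' @ M' @ R' \<noteq> []" "L @ M' @ R = concat (map f A) @ (L' @ M' @ R') @ concat (map f B)"
      by (simp_all add: LR)
    then show ?thesis unfolding V bounded_instance_around[OF xAB] using f(1,2) by blast
  qed
  show ?thesis using transfer[of "[c]" "[]"] transfer[of "[]" "[c]"] by auto
qed

text \<open>Inserting an arbitrary letter at position \<open>k |V|\<close> is a bijection that multiplies the number of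
  bounded instances by \<open>q\<close>, and the number of words as well.\<close>
lemma prob_bounded_instance_Suc:
  assumes q: "q > 0" and x: "count_list V x = 1" and n: "n > 2 * (k * length V)"
  shows "measure_pmf.prob (random_word q (Suc n)) {W. bounded_instance V x k W}
       = measure_pmf.prob (random_word q n) {W. bounded_instance V x k W}"
proof -
  let ?K = "k * length V" and ?B = "{W. bounded_instance V x k W}"
  have iff: "bounded_instance V x k (take ?K W @ c # drop ?K W) \<longleftrightarrow> bounded_instance V x k W"
    if "length W = n" for W :: "nat list" and c
    using bounded_instance_insert_iff[OF x, of k "take ?K W" "drop ?K W" c] n that by simp
  have "bij_betw (\<lambda>(W, c). take ?K W @ c # drop ?K W) ((words q n \<inter> ?B) \<times> {1..q}) (words q (Suc n) \<inter> ?B)"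
  proof (rule bij_betw_byWitness[where f' = "\<lambda>W. (take ?K W @ drop (Suc ?K) W, W ! ?K)"])
    have split: "W = take ?K W @ W ! ?K # drop (Suc ?K) W" if "length W = Suc n" for W :: "nat list"
      using that n by (intro id_take_nth_drop) simp
    show "\<forall>p\<in>(words q n \<inter> ?B) \<times> {1..q}. (\<lambda>W. (take ?K W @ drop (Suc ?K) W, W ! ?K))
        ((\<lambda>(W, c). take ?K W @ c # drop ?K W) p) = p"
      using n by (auto simp: words_def nth_append min_def)
    show "\<forall>W\<in>words q (Suc n) \<inter> ?B. (\<lambda>(W, c). take ?K W @ c # drop ?K W)
        ((\<lambda>W. (take ?K W @ drop (Suc ?K) W, W ! ?K)) W) = W"
      using n split by (auto simp: words_def min_def)
    show "(\<lambda>(W, c). take ?K W @ c # drop ?K W) ` ((words q n \<inter> ?B) \<times> {1..q}) \<subseteq> words q (Suc n) \<inter> ?B"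
      using n iff by (auto simp: words_def simp del: atLeastAtMost_iff One_nat_def
          dest!: in_set_takeD in_set_dropD)
    show "(\<lambda>W. (take ?K W @ drop (Suc ?K) W, W ! ?K)) ` (words q (Suc n) \<inter> ?B)
        \<subseteq> (words q n \<inter> ?B) \<times> {1..q}"
    proof (rule image_subsetI)
      fix W assume W: "W \<in> words q (Suc n) \<inter> ?B"
      let ?W = "take ?K W @ drop (Suc ?K) W"
      have len: "length W = Suc n" and set: "set W \<subseteq> {1..q}" using W by (auto simp: words_def)
      have "set ?W \<subseteq> {1..q}" using set by (auto dest!: in_set_takeD in_set_dropD)
      then have "?W \<in> words q n" using len n by (simp add: words_def)
      moreover have "bounded_instance V x k ?W"
        using bounded_instance_insert_iff[OF x, of k "take ?K W" "drop (Suc ?K) W" "W ! ?K"]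
          split[OF len] len n W by simp
      moreover have "W ! ?K \<in> {1..q}"
        using set len n by (intro subsetD[OF set] nth_mem) simp
      ultimately show "(?W, W ! ?K) \<in> (words q n \<inter> ?B) \<times> {1..q}" by blast
    qed
  qed
  then have "card (words q (Suc n) \<inter> ?B) = card (words q n \<inter> ?B) * q"
    by (simp add: bij_betw_same_card[symmetric] card_cartesian_product)
  then show ?thesis using q by (simp add: prob_random_word)
qed

lemma convergent_instance_prob:
  assumes "nondoubled V" and q: "q > 0"
  shows "convergent (\<lambda>n. instance_prob n V q)"
proof -
  obtain x where x: "count_list V x = 1" using assms(1) by (auto simp: nondoubled_def)
  have "Cauchy (\<lambda>n. instance_prob n V q)"
  proof (rule CauchyI)
    fix e :: real assume e: "e > 0"
    let ?P = "\<lambda>n. measure_pmf.prob (random_word q n)"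
    obtain k N where kN: "\<And>n. n \<ge> N \<Longrightarrow> ?P n {W. is_instance V W \<and> \<not> bounded_instance V x k W} \<le> e / 2"
      using bounded_suffices_nonrecurring[OF q x] half_gt_zero[OF e]
      unfolding bounded_suffices_def by blast
    define N' where "N' = max N (Suc (2 * (k * length V)))"
    define p where "p = ?P N' {W. bounded_instance V x k W}"
    have const: "?P n {W. bounded_instance V x k W} = p" if "n \<ge> N'" for n
      using that
    proof (induction n rule: dec_induct)
      case (step n)
      then show ?case using prob_bounded_instance_Suc[OF q x, of k n] by (simp add: N'_def)
    qed (simp add: p_def)
    have bounds: "p \<le> instance_prob n V q" "instance_prob n V q \<le> p + e / 2" if "n \<ge> N'" for n
    proof -
      have "?P n {W. bounded_instance V x k W} \<le> ?P n {W. is_instance V W}"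
        by (rule prob_random_word_mono[OF q]) (auto simp: bounded_instance_def is_instance_iff_subst)
      then show "p \<le> instance_prob n V q" using const[OF that] by (simp add: instance_prob_def)
      have "?P n {W. is_instance V W}
          \<le> ?P n ({W. bounded_instance V x k W} \<union> {W. is_instance V W \<and> \<not> bounded_instance V x k W})"
        by (rule prob_random_word_mono[OF q]) auto
      also have "\<dots> \<le> ?P n {W. bounded_instance V x k W} + ?P n {W. is_instance V W \<and> \<not> bounded_instance V x k W}"
        by (rule measure_Un_le) auto
      also have "\<dots> \<le> p + e / 2" using const[OF that] kN[of n] that by (simp add: N'_def)
      finally show "instance_prob n V q \<le> p + e / 2" by (simp add: instance_prob_def)
    qed
    show "\<exists>M. \<forall>m\<ge>M. \<forall>n\<ge>M. norm (instance_prob m V q - instance_prob n V q) < e"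
    proof (intro exI[of _ N'] allI impI)
      fix m n assume "m \<ge> N'" "n \<ge> N'"
      then show "norm (instance_prob m V q - instance_prob n V q) < e"
        using bounds[of m] bounds[of n] e by (simp add: abs_if)
    qed
  qed
  then show ?thesis by (simp add: Cauchy_convergent_iff)
qed

section \<open>Averaging over the factors\<close>
lemma sum_atMost_eq_choose_two: "(\<Sum>j\<le>n. j) = Suc n choose 2"
  by (induction n) (simp_all add: numeral_2_eq_2)

text \<open>A factor of length \<open>m\<close> of a uniformly random word is itself uniformly random, so it is an
  instance with probability \<open>instance_prob m V q\<close>. The inner sum collects the factors that end at
  position \<open>j\<close>.\<close>
lemma expectation_density_in:
  assumes q: "q > 0"
  shows "measure_pmf.expectation (random_word q n) (\<lambda>W. density_in V W)
       = (\<Sum>j\<le>n. \<Sum>m=1..j. instance_prob m V q) / real (Suc n choose 2)"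
proof -
  have count: "real (card {(i, j). i < j \<and> j \<le> length W \<and> is_instance V (factor W i j)})
      = (\<Sum>j\<le>n. \<Sum>i<j. indicator {W. factor W i j \<in> {U. is_instance V U}} W)" if "W \<in> words q n" for W
  proof -
    have len: "length W = n" using that by (simp add: words_def)
    have "{(i, j). i < j \<and> j \<le> length W \<and> is_instance V (factor W i j)}
        = prod.swap ` (SIGMA j:{..n}. {i\<in>{..<j}. is_instance V (factor W i j)})"
      by (auto simp: len image_iff)
    then have "card {(i, j). i < j \<and> j \<le> length W \<and> is_instance V (factor W i j)}
        = card (SIGMA j:{..n}. {i\<in>{..<j}. is_instance V (factor W i j)})"
      by (simp add: card_image)
    also have "\<dots> = (\<Sum>j\<le>n. card {i\<in>{..<j}. is_instance V (factor W i j)})"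
      by (rule card_SigmaI) auto
    finally show ?thesis
      by (simp add: indicator_def sum.If_cases Int_def)
  qed
  let ?P = "measure_pmf.prob (random_word q n)"
  have "measure_pmf.expectation (random_word q n) (\<lambda>W. density_in V W)
      = measure_pmf.expectation (random_word q n) (\<lambda>W.
          (\<Sum>j\<le>n. \<Sum>i<j. indicator {W. factor W i j \<in> {U. is_instance V U}} W) / real (Suc n choose 2))"
  proof (rule integral_cong_AE)
    show "AE W in random_word q n. density_in V W =
        (\<Sum>j\<le>n. \<Sum>i<j. indicator {W. factor W i j \<in> {U. is_instance V U}} W) / real (Suc n choose 2)"
      unfolding AE_measure_pmf_iff set_random_word[OF q]
      using count by (auto simp: density_in_def words_def)
  qed simp_all
  also have "\<dots> = (\<Sum>j\<le>n. \<Sum>i<j. ?P {W. factor W i j \<in> {U. is_instance V U}}) / real (Suc n choose 2)"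
    by (simp add: Bochner_Integration.integral_sum integrable_measure_pmf_finite set_random_word q finite_words)
  also have "(\<Sum>j\<le>n. \<Sum>i<j. ?P {W. factor W i j \<in> {U. is_instance V U}})
      = (\<Sum>j\<le>n. \<Sum>m=1..j. instance_prob m V q)"
  proof (rule sum.cong[OF refl])
    fix j assume "j \<in> {..n}"
    then have "?P {W. factor W i j \<in> {U. is_instance V U}} = instance_prob (j - i) V q" if "i < j" for i
      using prob_random_word_factor[OF q, of i "j - i" n "{U. is_instance V U}"] that
      by (simp add: instance_prob_def)
    then have "(\<Sum>i<j. ?P {W. factor W i j \<in> {U. is_instance V U}}) = (\<Sum>i<j. instance_prob (j - i) V q)"
      by simp
    also have "\<dots> = (\<Sum>m=1..j. instance_prob m V q)"
      by (rule sum.reindex_bij_witness[of _ "\<lambda>m. j - m" "\<lambda>i. j - i"]) auto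
    finally show "(\<Sum>i<j. ?P {W. factor W i j \<in> {U. is_instance V U}}) = (\<Sum>m=1..j. instance_prob m V q)" .
  qed
  finally show ?thesis .
qed

text \<open>In each inner sum the terms with \<open>m < N\<close> contribute a bounded amount, hence \<open>O(n)\<close> in total,
  which is negligible against the \<open>n (n + 1) / 2\<close> terms of the double sum.\<close>
lemma double_cesaro_tendsto:
  fixes a :: "nat \<Rightarrow> real"
  assumes "a \<longlonglongrightarrow> c"
  shows "(\<lambda>n. (\<Sum>j\<le>n. \<Sum>m=1..j. a m) / real (Suc n choose 2)) \<longlonglongrightarrow> c"
proof (rule LIMSEQ_I)
  fix e :: real assume e: "e > 0"
  obtain N where N: "\<And>m. m \<ge> N \<Longrightarrow> \<bar>a m - c\<bar> < e / 2"
    using LIMSEQ_D[OF assms half_gt_zero[OF e]] by auto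
  obtain D where D: "D > 0" "\<And>m. \<bar>a m - c\<bar> \<le> D"
  proof -
    have "Bseq (\<lambda>m. a m - c)"
      by (rule convergent_imp_Bseq[OF convergentI[OF tendsto_diff[OF assms tendsto_const]]])
    then show ?thesis using that by (auto simp: Bseq_def)
  qed
  have inner: "\<bar>(\<Sum>m=1..j. a m) - real j * c\<bar> \<le> D * real N + e / 2 * real j" for j
  proof -
    have "\<bar>(\<Sum>m=1..j. a m) - real j * c\<bar> = \<bar>\<Sum>m=1..j. a m - c\<bar>"
      by (simp add: sum_subtractf)
    also have "\<dots> \<le> (\<Sum>m=1..j. \<bar>a m - c\<bar>)" by (rule sum_abs)
    also have "\<dots> \<le> (\<Sum>m=1..j. (if m < N then D else 0) + e / 2)"
      using N D e by (intro sum_mono) (auto simp: not_less intro: less_imp_le add_increasing2)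
    also have "\<dots> = D * real (card ({1..j} \<inter> {m. m < N})) + e / 2 * real j"
      by (simp add: sum.distrib sum.If_cases)
    also have "card ({1..j} \<inter> {m. m < N}) \<le> card {..<N}"
      by (intro card_mono) auto
    finally show ?thesis using D(1) by simp
  qed
  have outer: "\<bar>(\<Sum>j\<le>n. \<Sum>m=1..j. a m) - real (Suc n choose 2) * c\<bar>
      \<le> D * real N * real (Suc n) + e / 2 * real (Suc n choose 2)" for n
  proof -
    have tri: "(\<Sum>j\<le>n. real j) = real (Suc n choose 2)"
      by (simp only: sum_atMost_eq_choose_two[symmetric] of_nat_sum)
    have "\<bar>(\<Sum>j\<le>n. \<Sum>m=1..j. a m) - real (Suc n choose 2) * c\<bar>
        = \<bar>\<Sum>j\<le>n. (\<Sum>m=1..j. a m) - real j * c\<bar>"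
      by (simp only: sum_subtractf sum_distrib_right[symmetric] tri)
    also have "\<dots> \<le> (\<Sum>j\<le>n. \<bar>(\<Sum>m=1..j. a m) - real j * c\<bar>)" by (rule sum_abs)
    also have "\<dots> \<le> (\<Sum>j\<le>n. D * real N + e / 2 * real j)" by (intro sum_mono inner)
    also have "\<dots> = D * real N * real (Suc n) + e / 2 * real (Suc n choose 2)"
      by (simp only: sum.distrib sum_distrib_left[symmetric] tri) (simp add: algebra_simps)
    finally show ?thesis .
  qed
  have "(\<lambda>n. 2 * (D * real N) / real n) \<longlonglongrightarrow> 0" by real_asymp
  then have "\<forall>\<^sub>F n in sequentially. 2 * (D * real N) / real n < e / 2"
    using e by (intro order_tendstoD) auto
  then have "\<forall>\<^sub>F n in sequentially. n > 0 \<and> 2 * (D * real N) / real n < e / 2"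
    using eventually_gt_at_top[of 0] by (rule eventually_conj[rotated])
  then obtain M where M: "\<And>n. n \<ge> M \<Longrightarrow> n > 0 \<and> 2 * (D * real N) / real n < e / 2"
    by (auto simp: eventually_sequentially)
  show "\<exists>M. \<forall>n\<ge>M. norm ((\<Sum>j\<le>n. \<Sum>m=1..j. a m) / real (Suc n choose 2) - c) < e"
  proof (intro exI[of _ M] allI impI)
    fix n assume "n \<ge> M"
    then have n: "n > 0" "2 * (D * real N) / real n < e / 2" using M by auto
    define T where "T = real (Suc n choose 2)"
    have "2 * (Suc n choose 2) = Suc n * n"
      by (simp add: choose_two)
    then have "real (2 * (Suc n choose 2)) = real (Suc n * n)" by (simp only:)
    then have T: "T = real (Suc n) * real n / 2" by (simp add: T_def field_simps)
    have T_pos: "T > 0" unfolding T using n(1) by simp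
    have "norm ((\<Sum>j\<le>n. \<Sum>m=1..j. a m) / T - c) = \<bar>(\<Sum>j\<le>n. \<Sum>m=1..j. a m) - T * c\<bar> / T"
      using T_pos by (simp add: field_simps abs_div_pos[symmetric] del: abs_div_pos)
    also have "\<dots> \<le> (D * real N * real (Suc n) + e / 2 * T) / T"
      using outer[of n] T_pos by (simp only: T_def divide_right_mono less_imp_le)
    also have "\<dots> = D * real N * real (Suc n) / T + e / 2"
      using T_pos by (simp add: field_simps)
    also have "D * real N * real (Suc n) / T = 2 * (D * real N) / real n"
      using n(1) by (simp add: T del: of_nat_Suc)
    finally show "norm ((\<Sum>j\<le>n. \<Sum>m=1..j. a m) / real (Suc n choose 2) - c) < e"
      using n(2) by (simp add: T_def)
  qed
qed

text \<open>Since \<open>lim\<close> is meaningful only for convergent sequences, \<open>convergent_instance_prob\<close> is also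
  what identifies the limit of the averages with \<open>limit_instance_prob V q\<close>.\<close>
theorem corollary4p12:
  fixes V :: "'a list" and q :: nat
  assumes "nondoubled V" and "q > 0"
  shows "(\<lambda>n. measure_pmf.expectation (random_word q n) (\<lambda>W. density_in V W))
           \<longlonglongrightarrow> limit_instance_prob V q"
proof -
  have "(\<lambda>n. instance_prob n V q) \<longlonglongrightarrow> limit_instance_prob V q"
    unfolding limit_instance_prob_def convergent_LIMSEQ_iff[symmetric]
    by (rule convergent_instance_prob[OF assms])
  from double_cesaro_tendsto[OF this] show ?thesis
    by (simp only: expectation_density_in[OF assms(2)])
qed

end
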